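(* For all positive integers $n$, $$\upsilon(T_{3,3n+1})=-2n,\qquad \upsilon(T_{3,3n+2})=-2n-1,\qquad \upsilon(T_{4,2n+1})=-2n.$$
   Context: For coprime positive integers $p,q$, $T_{p,q}$ denotes the positive torus knot. $\upsilon=\Upsilon(1)$, where $\Upsilon$ is the concordance invariant of Ozsváth, Stipsicz, and Szabó, which assigns to a knot $K$ a function $\Upsilon_K:[0,2]\to\mathbb{R}$. For torus knots it is given (Ozsváth–Stipsicz–Szabó) as follows. Write the symmetrized Alexander polynomial $$\Delta(T_{p,q})=t^{-\frac{(p-1)(q-1)}{2}}\frac{(t^{pq}-1)(t-1)}{(t^p-1)(t^q-1)}=\sum_{k=0}^{l}(-1)^kt^{\alpha_k}$$ with $(\alpha_k)_{k=0}^l$ a decreasing sequence of integers, and define integers $m_0=0$, $m_{2k}=m_{2k-1}-1$, $m_{2k+1}=m_{2k}-2(\alpha_{2k}-\alpha_{2k+1})+1$. Then $\Upsilon_{T_{p,q}}(t)=\max_{0\leq 2k\leq l}\{m_{2k}-t\alpha_{2k}\}$; in particular $\upsilon(T_{p,q})=\max_{0\leq 2k\leq l}\{m_{2k}-\alpha_{2k}\}$. *)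

theory Defs
  imports Complex_Main "HOL-Computational_Algebra.Formal_Laurent_Series"
begin

text \<open>
  A torus knot \<open>T\<^bsub>p,q\<^esub>\<close> is represented by its parameters. Its symmetrized Alexander polynomial
  is the quotient below, taken in the field of formal Laurent series over the rationals, which
  contains the Laurent polynomials. The integer division by 2 is exact for coprime \<open>p\<close>, \<open>q\<close>.
\<close>

definition alexander_torus :: "nat \<Rightarrow> nat \<Rightarrow> rat fls" where
  "alexander_torus p q =
     fls_X_intpow (- ((int p - 1) * (int q - 1) div 2)) *
     (((fls_X ^ (p * q) - 1) * (fls_X - 1)) / ((fls_X ^ p - 1) * (fls_X ^ q - 1)))"

definition is_alternating_expansion :: "rat fls \<Rightarrow> int list \<Rightarrow> bool" where
  "is_alternating_expansion f as \<longleftrightarrow>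
     sorted_wrt (>) as \<and> f = (\<Sum>k<length as. (- 1) ^ k * fls_X_intpow (as ! k))"

lemma fls_nth_alternating_sum:
  fixes as :: "int list"
  assumes "distinct as" and "j < length as"
  shows "fls_nth (\<Sum>k<length as. (- 1) ^ k * fls_X_intpow (as ! k) :: rat fls) (as ! j) = (- 1) ^ j"
proof -
  have nth: "fls_nth ((- 1) ^ k * fls_X_intpow a :: rat fls) i = (if i = a then (- 1) ^ k else 0)"
    for k :: nat and a i :: int
    by (cases "even k") auto
  have "(\<Sum>k<length as. if as ! j = as ! k then (- 1 :: rat) ^ k else 0) =
        (\<Sum>k<length as. if k = j then (- 1) ^ k else 0)"
    using assms by (intro sum.cong) (auto simp: nth_eq_iff_index_eq)
  then show ?thesis
    using assms by (simp add: fls_nth_sum nth)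
qed

lemma fls_nth_alternating_sum_0:
  fixes as :: "int list"
  assumes "a \<notin> set as"
  shows "fls_nth (\<Sum>k<length as. (- 1) ^ k * fls_X_intpow (as ! k) :: rat fls) a = 0"
proof -
  have nth: "fls_nth ((- 1) ^ k * fls_X_intpow b :: rat fls) i = (if i = b then (- 1) ^ k else 0)"
    for k :: nat and b i :: int
    by (cases "even k") auto
  show ?thesis
    using assms by (auto simp: fls_nth_sum nth intro!: sum.neutral)
qed

lemma is_alternating_expansion_set:
  assumes "is_alternating_expansion f as"
  shows "set as = {a. fls_nth f a \<noteq> 0}"
proof -
  have "distinct as"
    using assms by (auto simp: is_alternating_expansion_def sorted_wrt_iff_nth_less distinct_conv_nth)
      (metis less_irrefl nat_neq_iff)
  then show ?thesis
    using assms fls_nth_alternating_sum fls_nth_alternating_sum_0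
    by (auto simp: is_alternating_expansion_def in_set_conv_nth)
       (metis in_set_conv_nth fls_nth_alternating_sum_0)
qed

lemma is_alternating_expansion_unique:
  assumes "is_alternating_expansion f as" and "is_alternating_expansion f bs"
  shows "as = bs"
proof -
  have "set (rev as) = set (rev bs)"
    using assms by (simp add: is_alternating_expansion_set)
  moreover have "sorted_wrt (<) (rev as)" "sorted_wrt (<) (rev bs)"
    using assms by (simp_all add: is_alternating_expansion_def sorted_wrt_rev)
  ultimately have "rev as = rev bs"
    using strict_sorted_equal by blast
  then show ?thesis by simp
qed

definition torus_exponents :: "nat \<Rightarrow> nat \<Rightarrow> int list" where
  "torus_exponents p q = (THE as. is_alternating_expansion (alexander_torus p q) as)"

lemma torus_exponents_eqI:
  "is_alternating_expansion (alexander_torus p q) as \<Longrightarrow> torus_exponents p q = as"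
  unfolding torus_exponents_def using is_alternating_expansion_unique by blast

fun m_seq :: "(nat \<Rightarrow> int) \<Rightarrow> nat \<Rightarrow> int" where
  "m_seq \<alpha> 0 = 0"
| "m_seq \<alpha> (Suc j) =
     (if even (Suc j) then m_seq \<alpha> j - 1 else m_seq \<alpha> j - 2 * (\<alpha> j - \<alpha> (Suc j)) + 1)"

text \<open>
  The general definition of \<open>\<Upsilon>\<close> uses knot Floer homology; for torus knots we take the
  formula of Ozsvath, Stipsicz and Szabo. The last index \<open>l\<close> of the exponent sequence is
  the length of the list minus one, so \<open>2k \<le> l\<close> reads \<open>2k < length\<close>.
\<close>

definition Upsilon_torus :: "nat \<Rightarrow> nat \<Rightarrow> real \<Rightarrow> real" where
  "Upsilon_torus p q t =
     (let \<alpha> = (\<lambda>k. torus_exponents p q ! k)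
      in Max {real_of_int (m_seq \<alpha> (2 * k)) - t * real_of_int (\<alpha> (2 * k)) | k.
                2 * k < length (torus_exponents p q)})"

definition upsilon_torus :: "nat \<Rightarrow> nat \<Rightarrow> real" where
  "upsilon_torus p q = Upsilon_torus p q 1"

end

theory Submission
  imports Defs
begin

text \<open>
  Pair the consecutive gaps of the exponent sequence: \<open>a\<^sub>k = \<alpha>\<^sub>2\<^sub>k - \<alpha>\<^sub>2\<^sub>k\<^sub>+\<^sub>1\<close> and
  \<open>b\<^sub>k = \<alpha>\<^sub>2\<^sub>k\<^sub>+\<^sub>1 - \<alpha>\<^sub>2\<^sub>k\<^sub>+\<^sub>2\<close>. Then \<open>m\<^sub>2\<^sub>k - \<alpha>\<^sub>2\<^sub>k\<close> starts at minus the genus and changes by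
  \<open>b\<^sub>k - a\<^sub>k\<close> in each step, so \<open>\<upsilon>\<close> is minus the genus plus the maximal height of this walk.
  Since \<open>(t\<^sup>p\<^sup>q - 1) (t - 1) / ((t\<^sup>p - 1) (t\<^sup>q - 1))\<close> is \<open>1 - t\<close> times the generating function of
  the semigroup generated by \<open>p\<close> and \<open>q\<close>, the gaps are read off from that semigroup; they are
  \<^item> \<open>(1,2)\<^sup>n (2,1)\<^sup>n\<close> for \<open>T\<^bsub>3,3n+1\<^esub>\<close>,
  \<^item> \<open>(1,2)\<^sup>n (1,1) (2,1)\<^sup>n\<close> for \<open>T\<^bsub>3,3n+2\<^esub>\<close>,
  \<^item> \<open>(1,3)\<^sup>m (2,2)\<^sup>m (3,1)\<^sup>m\<close> for \<open>T\<^bsub>4,4m+1\<^esub>\<close>,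
  \<^item> \<open>(1,3)\<^sup>m (1,2) (2,2)\<^sup>m (2,1) (3,1)\<^sup>m\<close> for \<open>T\<^bsub>4,4m+3\<^esub>\<close>.
\<close>

section \<open>Gap lists, their exponents and polynomials\<close>

fun exponents_of_gaps :: "int \<Rightarrow> (nat \<times> nat) list \<Rightarrow> int list" where
  "exponents_of_gaps h [] = [h]"
| "exponents_of_gaps h ((a, b) # ps) =
     h # (h - int a) # exponents_of_gaps (h - int a - int b) ps"

fun total_gap :: "(nat \<times> nat) list \<Rightarrow> nat" where
  "total_gap [] = 0"
| "total_gap ((a, b) # ps) = a + b + total_gap ps"

text \<open>Normalized so that the lowest exponent is 0: only natural powers of \<open>x\<close>
  occur, which suits ring identities.\<close>

fun gap_poly :: "'a::comm_ring_1 \<Rightarrow> (nat \<times> nat) list \<Rightarrow> 'a" where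
  "gap_poly x [] = 1"
| "gap_poly x ((a, b) # ps) = x ^ (b + total_gap ps) * (x ^ a - 1) + gap_poly x ps"

text \<open>Maximal height of the walk with steps \<open>b - a\<close>, the starting height 0
  included.\<close>

fun peak :: "(nat \<times> nat) list \<Rightarrow> int" where
  "peak [] = 0"
| "peak ((a, b) # ps) = max 0 (int b - int a + peak ps)"

lemma exponents_of_gaps_le: "x \<in> set (exponents_of_gaps h ps) \<Longrightarrow> x \<le> h"
  by (induction h ps rule: exponents_of_gaps.induct) auto

lemma sorted_exponents_of_gaps:
  assumes "\<forall>(a, b) \<in> set ps. 0 < a \<and> 0 < b"
  shows "sorted_wrt (>) (exponents_of_gaps h ps)"
  using assms
  by (induction h ps rule: exponents_of_gaps.induct) (auto dest!: exponents_of_gaps_le)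

text \<open>A pair takes up two positions, so the signs of the tail do not change and induction
  applies.\<close>

lemma alternating_sum_exponents_of_gaps:
  "(\<Sum>k<length (exponents_of_gaps h ps).
      (- 1) ^ k * fls_X_intpow (exponents_of_gaps h ps ! k) :: rat fls) =
   fls_X_intpow (h - int (total_gap ps)) * gap_poly fls_X ps"
proof (induction h ps rule: exponents_of_gaps.induct)
  case (1 h)
  then show ?case by simp
next
  case (2 h a b ps)
  let ?d = "h - int (total_gap ((a, b) # ps))"
  have shift: "fls_X_intpow (i + int n) = (fls_X_intpow i * fls_X ^ n :: rat fls)" for i n
    by (simp add: fls_X_power_conv_shift_1 fls_times_both_shifted_simp)
  have "h = ?d + int (a + (b + total_gap ps))" "h - int a = ?d + int (b + total_gap ps)"
    by simp_all
  then have tops: "(fls_X_intpow h :: rat fls) = fls_X_intpow ?d * fls_X ^ (a + (b + total_gap ps))"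
      "(fls_X_intpow (h - int a) :: rat fls) = fls_X_intpow ?d * fls_X ^ (b + total_gap ps)"
    by (metis shift)+
  show ?case
    by (simp only: exponents_of_gaps.simps list.size sum.lessThan_Suc_shift add_Suc_right add_0_right
          nth_Cons_0 nth_Cons_Suc power_0 power_Suc mult_minus_left mult_1_left minus_minus 2 tops o_def)
       (simp add: algebra_simps power_add)
qed

lemma total_gap_append: "total_gap (ps @ qs) = total_gap ps + total_gap qs"
  by (induction ps rule: total_gap.induct) auto

lemma total_gap_replicate: "total_gap (replicate n (a, b)) = n * (a + b)"
  by (induction n) auto

text \<open>A geometric series with ratio \<open>x ^ (a + b)\<close>, cleared of its
  denominator.\<close>

lemma gap_poly_replicate_append:
  fixes x :: "'a::comm_ring_1"
  shows "gap_poly x (replicate n (a, b) @ ps) * (x ^ (a + b) - 1) =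
    x ^ (b + total_gap ps) * (x ^ a - 1) * (x ^ (n * (a + b)) - 1) + gap_poly x ps * (x ^ (a + b) - 1)"
  by (induction n) (simp_all add: total_gap_append total_gap_replicate algebra_simps power_add)

section \<open>From the recursion for m to the peak\<close>

lemma m_seq_Suc_Suc:
  "m_seq \<alpha> (2 * Suc k) = m_seq (\<lambda>j. \<alpha> (Suc (Suc j))) (2 * k) - 2 * (\<alpha> 0 - \<alpha> 1)"
proof (induction k)
  case 0
  then show ?case by (simp add: numeral_2_eq_2)
qed auto

text \<open>Prepending \<open>(a, b)\<close> adds the value \<open>- h\<close> and lowers the values
  of the tail by \<open>2 * a\<close>. The tail starts at \<open>h - a - b\<close>, so its maximum
  becomes \<open>peak ps - h + b - a\<close>, which matches the recursion of
  \<open>peak\<close>.\<close>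

lemma m_seq_values_exponents_of_gaps:
  fixes h :: int and ps
  defines "V \<equiv> \<lambda>h ps. {m_seq ((!) (exponents_of_gaps h ps)) (2 * k) - exponents_of_gaps h ps ! (2 * k) | k.
                   2 * k < length (exponents_of_gaps h ps)}"
  shows "finite (V h ps) \<and> V h ps \<noteq> {} \<and> Max (V h ps) = peak ps - h"
proof (induction h ps rule: exponents_of_gaps.induct)
  case (1 h)
  have "V h [] = {- h}"
    by (auto simp: V_def)
  then show ?case by simp
next
  case (2 h a b ps)
  let ?h = "h - int a - int b"
  let ?E = "exponents_of_gaps h ((a, b) # ps)" and ?F = "exponents_of_gaps ?h ps"
  have step: "m_seq ((!) ?E) (2 * Suc k) - ?E ! (2 * Suc k) =
      m_seq ((!) ?F) (2 * k) - ?F ! (2 * k) - 2 * int a" for k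
    by (subst m_seq_Suc_Suc) simp
  have "V h ((a, b) # ps) = insert (- h) ((\<lambda>v. v - 2 * int a) ` V ?h ps)" (is "?L = ?R")
  proof
    show "?L \<subseteq> ?R"
    proof
      fix v assume "v \<in> ?L"
      then obtain k where k: "v = m_seq ((!) ?E) (2 * k) - ?E ! (2 * k)" "2 * k < length ?E"
        by (auto simp: V_def)
      show "v \<in> ?R"
      proof (cases k)
        case 0
        then show ?thesis using k by simp
      next
        case (Suc j)
        then have "v = m_seq ((!) ?F) (2 * j) - ?F ! (2 * j) - 2 * int a" "2 * j < length ?F"
          using k step[of j] by simp_all
        then show ?thesis by (auto simp: V_def)
      qed
    qed
    show "?R \<subseteq> ?L"
    proof
      fix v assume "v \<in> ?R"
      then consider "v = - h"
        | j where "v = m_seq ((!) ?F) (2 * j) - ?F ! (2 * j) - 2 * int a" "2 * j < length ?F"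
        by (auto simp: V_def)
      then show "v \<in> ?L"
      proof cases
        case 1
        then show ?thesis unfolding V_def by (intro CollectI exI[of _ 0]) simp
      next
        case (2 j)
        then show ?thesis unfolding V_def
          by (intro CollectI exI[of _ "Suc j"] conjI) (simp_all only: step, simp)
      qed
    qed
  qed
  moreover have "Max ((\<lambda>v. v - 2 * int a) ` V ?h ps) = Max (V ?h ps) - 2 * int a"
    using 2 by (intro mono_Max_commute[symmetric] monoI) auto
  ultimately show ?case
    using 2 by auto
qed

text \<open>\<open>poly\<close> is the Alexander quotient with denominators cleared. Total gap
  \<open>2 * g\<close> lets the exponents run from \<open>g\<close> down to \<open>- g\<close>, as
  symmetrization demands.\<close>

lemma upsilon_torus_eq_peak:
  assumes pos: "\<forall>(a, b) \<in> set ps. 0 < a \<and> 0 < b"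
    and pq: "0 < p" "0 < q"
    and poly: "\<And>x :: rat fls. gap_poly x ps * (x ^ p - 1) * (x ^ q - 1) = (x ^ (p * q) - 1) * (x - 1)"
    and genus: "total_gap ps = 2 * g" "(p - 1) * (q - 1) = 2 * g"
  shows "upsilon_torus p q = real_of_int (peak ps - int g)"
proof -
  let ?E = "exponents_of_gaps (int g) ps"
  have X_power_neq: "(fls_X :: rat fls) ^ r - 1 \<noteq> 0" if "0 < r" for r
  proof
    assume "(fls_X :: rat fls) ^ r - 1 = 0"
    then have "fls_nth ((fls_X :: rat fls) ^ r) 0 = fls_nth 1 0" by simp
    then show False using that by (simp add: fls_X_power_nth)
  qed
  \<comment> \<open>The hypothesis uses truncated subtraction; positivity of \<open>p\<close> and
    \<open>q\<close> carries it over to the integers.\<close>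
  have "(int p - 1) * (int q - 1) = 2 * int g"
    using genus(2) pq by (metis Suc_leI int_ops(2,7) of_nat_diff of_nat_numeral One_nat_def)
  then have "alexander_torus p q = fls_X_intpow (- int g) * gap_poly fls_X ps"
    using X_power_neq[OF pq(1)] X_power_neq[OF pq(2)]
    by (simp add: alexander_torus_def poly[symmetric])
  then have "is_alternating_expansion (alexander_torus p q) ?E"
    using sorted_exponents_of_gaps[OF pos] genus(1)
    by (simp add: is_alternating_expansion_def alternating_sum_exponents_of_gaps)
  then have E: "torus_exponents p q = ?E"
    by (rule torus_exponents_eqI)
  let ?V = "{m_seq ((!) ?E) (2 * k) - ?E ! (2 * k) | k. 2 * k < length ?E}"
  have "upsilon_torus p q = Max (real_of_int ` ?V)"
    unfolding upsilon_torus_def Upsilon_torus_def E Let_def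
    by (rule arg_cong[of _ _ Max]) (auto simp: image_iff simp flip: of_int_diff)
  also have "\<dots> = real_of_int (Max ?V)"
    using m_seq_values_exponents_of_gaps[of "int g" ps]
    by (intro mono_Max_commute[symmetric] monoI) simp_all
  also have "Max ?V = peak ps - int g"
    using m_seq_values_exponents_of_gaps[of "int g" ps] by simp
  finally show ?thesis .
qed

section \<open>Peaks of block lists and the four families\<close>

lemma peak_nonneg: "0 \<le> peak ps"
  by (cases ps rule: peak.cases) auto

text \<open>The cutoff at 0 never acts, because the height still to be gained is
  nonnegative.\<close>

lemma peak_replicate_up:
  assumes "a \<le> b"
  shows "peak (replicate n (a, b) @ ps) = int n * (int b - int a) + peak ps"
proof (induction n)
  case (Suc n)
  have "0 \<le> int n * (int b - int a)" using assms by simp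
  then show ?case using assms peak_nonneg[of ps] Suc by (simp add: algebra_simps)
qed simp

lemma peak_replicate_down: "b \<le> a \<Longrightarrow> peak (replicate n (a, b)) = 0"
  by (induction n) auto

lemma upsilon_torus_3_1: "upsilon_torus 3 (3 * n + 1) = - 2 * real n"
proof -
  let ?qs = "replicate n (2, 1) @ []"
  let ?ps = "replicate n (1, 2) @ ?qs"
  have "upsilon_torus 3 (3 * n + 1) = real_of_int (peak ?ps - int (3 * n))"
  proof (rule upsilon_torus_eq_peak)
    fix x :: "rat fls"
    \<comment> \<open>Hiding this power removes \<open>n\<close> from the exponents, so one
      polynomial identity in \<open>x\<close> and \<open>y\<close> covers all
      \<open>n\<close>.\<close>
    define y where "y = x ^ (n * 3)"
    have P: "gap_poly x ?ps * (x ^ 3 - 1) = x ^ 2 * y * (x - 1) * (y - 1) + gap_poly x ?qs * (x ^ 3 - 1)"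
      using gap_poly_replicate_append[of x n 1 2 ?qs]
      by (simp add: total_gap_replicate power_add y_def eval_nat_numeral)
    have Q: "gap_poly x ?qs * (x ^ 3 - 1) = x * (x ^ 2 - 1) * (y - 1) + (x ^ 3 - 1)"
      using gap_poly_replicate_append[of x n 2 1 "[]"] by (simp add: y_def eval_nat_numeral)
    have pows: "x ^ (3 * n + 1) = y * x" "x ^ (3 * (3 * n + 1)) = y ^ 3 * x ^ 3"
      by (simp_all add: y_def power_add mult.commute flip: power_mult)
    show "gap_poly x ?ps * (x ^ 3 - 1) * (x ^ (3 * n + 1) - 1) =
        (x ^ (3 * (3 * n + 1)) - 1) * (x - 1)"
      by (simp only: P Q pows distrib_right) algebra
  qed (auto simp: total_gap_append total_gap_replicate)
  also have "peak ?ps = int n"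
    by (simp add: peak_replicate_up peak_replicate_down)
  finally show ?thesis by simp
qed

lemma upsilon_torus_3_2: "upsilon_torus 3 (3 * n + 2) = - 2 * real n - 1"
proof -
  let ?qs = "replicate n (2, 1) @ []"
  let ?ps = "replicate n (1, 2) @ (1, 1) # ?qs"
  have "upsilon_torus 3 (3 * n + 2) = real_of_int (peak ?ps - int (3 * n + 1))"
  proof (rule upsilon_torus_eq_peak)
    fix x :: "rat fls"
    define y where "y = x ^ (n * 3)"
    have P: "gap_poly x ?ps * (x ^ 3 - 1) =
        x ^ 4 * y * (x - 1) * (y - 1) + (x * y * (x - 1) + gap_poly x ?qs) * (x ^ 3 - 1)"
      using gap_poly_replicate_append[of x n 1 2 "(1, 1) # ?qs"]
      by (simp add: total_gap_replicate power_add y_def eval_nat_numeral)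
    have Q: "gap_poly x ?qs * (x ^ 3 - 1) = x * (x ^ 2 - 1) * (y - 1) + (x ^ 3 - 1)"
      using gap_poly_replicate_append[of x n 2 1 "[]"] by (simp add: y_def eval_nat_numeral)
    have pows: "x ^ (3 * n + 2) = y * x ^ 2" "x ^ (3 * (3 * n + 2)) = y ^ 3 * x ^ 6"
      by (simp_all add: y_def power_add mult.commute flip: power_mult power2_eq_square)
    show "gap_poly x ?ps * (x ^ 3 - 1) * (x ^ (3 * n + 2) - 1) =
        (x ^ (3 * (3 * n + 2)) - 1) * (x - 1)"
      \<comment> \<open>\<open>distrib_right\<close> exposes the product that \<open>Q\<close>
        rewrites.\<close>
      by (simp only: P Q pows distrib_right) algebra
  qed (auto simp: total_gap_append total_gap_replicate)
  also have "peak ?ps = int n"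
    by (simp add: peak_replicate_up peak_replicate_down)
  finally show ?thesis by simp
qed

text \<open>The three blocks climb by 2 per step, stay level and descend, so the peak is
  \<open>2 * m\<close>; the genus is \<open>6 * m\<close>.\<close>

lemma upsilon_torus_4_1: "upsilon_torus 4 (4 * m + 1) = - 4 * real m"
proof -
  let ?rs = "replicate m (3, 1) @ []"
  let ?qs = "replicate m (2, 2) @ ?rs"
  let ?ps = "replicate m (1, 3) @ ?qs"
  have "upsilon_torus 4 (4 * m + 1) = real_of_int (peak ?ps - int (6 * m))"
  proof (rule upsilon_torus_eq_peak)
    fix x :: "rat fls"
    define y where "y = x ^ (m * 4)"
    have P: "gap_poly x ?ps * (x ^ 4 - 1) =
        x ^ 3 * y * y * (x - 1) * (y - 1) + gap_poly x ?qs * (x ^ 4 - 1)"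
      using gap_poly_replicate_append[of x m 1 3 ?qs]
      by (simp add: total_gap_append total_gap_replicate power_add y_def eval_nat_numeral)
    have Q: "gap_poly x ?qs * (x ^ 4 - 1) =
        x ^ 2 * y * (x ^ 2 - 1) * (y - 1) + gap_poly x ?rs * (x ^ 4 - 1)"
      using gap_poly_replicate_append[of x m 2 2 ?rs]
      by (simp add: total_gap_replicate power_add y_def eval_nat_numeral)
    have R: "gap_poly x ?rs * (x ^ 4 - 1) = x * (x ^ 3 - 1) * (y - 1) + (x ^ 4 - 1)"
      using gap_poly_replicate_append[of x m 3 1 "[]"] by (simp add: y_def eval_nat_numeral)
    have pows: "x ^ (4 * m + 1) = y * x" "x ^ (4 * (4 * m + 1)) = y ^ 4 * x ^ 4"
      by (simp_all add: y_def power_add mult.commute flip: power_mult)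
    show "gap_poly x ?ps * (x ^ 4 - 1) * (x ^ (4 * m + 1) - 1) =
        (x ^ (4 * (4 * m + 1)) - 1) * (x - 1)"
      by (simp only: P Q R pows distrib_right) algebra
  qed (auto simp: total_gap_append total_gap_replicate)
  also have "peak ?ps = 2 * int m"
    by (simp add: peak_replicate_up peak_replicate_down)
  finally show ?thesis by simp
qed

text \<open>The extra pair \<open>(1, 2)\<close> raises the peak by 1, while \<open>(2, 1)\<close>
  already descends; the genus is \<open>6 * m + 3\<close>.\<close>

lemma upsilon_torus_4_3: "upsilon_torus 4 (4 * m + 3) = - 4 * real m - 2"
proof -
  let ?rs = "replicate m (3, 1) @ []"
  let ?qs = "replicate m (2, 2) @ (2, 1) # ?rs"
  let ?ps = "replicate m (1, 3) @ (1, 2) # ?qs"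
  have "upsilon_torus 4 (4 * m + 3) = real_of_int (peak ?ps - int (6 * m + 3))"
  proof (rule upsilon_torus_eq_peak)
    fix x :: "rat fls"
    define y where "y = x ^ (m * 4)"
    have P: "gap_poly x ?ps * (x ^ 4 - 1) = x ^ 9 * y * y * (x - 1) * (y - 1) +
        (x ^ 5 * y * y * (x - 1) + gap_poly x ?qs) * (x ^ 4 - 1)"
      using gap_poly_replicate_append[of x m 1 3 "(1, 2) # ?qs"]
      by (simp add: total_gap_append total_gap_replicate power_add y_def eval_nat_numeral)
    have Q: "gap_poly x ?qs * (x ^ 4 - 1) = x ^ 5 * y * (x ^ 2 - 1) * (y - 1) +
        (x * y * (x ^ 2 - 1) + gap_poly x ?rs) * (x ^ 4 - 1)"
      using gap_poly_replicate_append[of x m 2 2 "(2, 1) # ?rs"]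
      by (simp add: total_gap_replicate power_add y_def eval_nat_numeral)
    have R: "gap_poly x ?rs * (x ^ 4 - 1) = x * (x ^ 3 - 1) * (y - 1) + (x ^ 4 - 1)"
      using gap_poly_replicate_append[of x m 3 1 "[]"] by (simp add: y_def eval_nat_numeral)
    have pows: "x ^ (4 * m + 3) = y * x ^ 3" "x ^ (4 * (4 * m + 3)) = y ^ 4 * x ^ 12"
      by (simp_all add: y_def power_add mult.commute flip: power_mult)
    show "gap_poly x ?ps * (x ^ 4 - 1) * (x ^ (4 * m + 3) - 1) =
        (x ^ (4 * (4 * m + 3)) - 1) * (x - 1)"
      by (simp only: P Q R pows distrib_right) algebra
  qed (auto simp: total_gap_append total_gap_replicate)
  also have "peak ?ps = 2 * int m + 1"
    by (simp add: peak_replicate_up peak_replicate_down)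
  finally show ?thesis by simp
qed

theorem proposition28:
  fixes n :: nat
  assumes "n > 0"
  shows "upsilon_torus 3 (3 * n + 1) = - 2 * real n \<and>
         upsilon_torus 3 (3 * n + 2) = - 2 * real n - 1 \<and>
         upsilon_torus 4 (2 * n + 1) = - 2 * real n"
proof -
  have "upsilon_torus 4 (2 * n + 1) = - 2 * real n"
  proof (cases "even n")
    case True
    then obtain m where "n = 2 * m" by blast
    then show ?thesis using upsilon_torus_4_1[of m] by simp
  next
    case False
    then obtain m where m: "n = 2 * m + 1" by (rule oddE)
    then have "upsilon_torus 4 (2 * n + 1) = upsilon_torus 4 (4 * m + 3)"
      by (intro arg_cong[of _ _ "upsilon_torus 4"]) simp
    then show ?thesis using m upsilon_torus_4_3[of m] by simp
  qed
  then show ?thesis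
    using upsilon_torus_3_1 upsilon_torus_3_2 by blast
qed

end
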